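(* Let $X$ be an orientable surface, let $\mu$ be an ideal triangulation of $X$, and let $e\neq f$ be two distinct ends of $X$. Then $\mu$ contains only finitely many arcs between $e$ and $f$.
   Context: Surfaces are connected, orientable and without boundary. Ends of $X$ are taken in the usual sense: an end is an equivalence class of nested sequences $U_1\supset U_2\supset\cdots$ of connected, non-relatively-compact subsurfaces with compact boundary that eventually leave every compact set, two sequences $\{U_i\}$, $\{V_j\}$ being equivalent if every $V_j$ contains some $U_i$ and every $U_i$ contains some $V_j$. Isolated planar ends are called punctures; every end (puncture or not) may be an endpoint of an arc. An arc of $X$ is a proper embedding $\alpha:\mathbb{R}\to X$ such that $\alpha(t)$ converges to an end of $X$ as $t\to+\infty$ and to an end of $X$ as $t\to-\infty$ (the two ends need not be distinct); the arc is said to be between these two ends. An arc is identified with its image; since $X$ is orientable, each arc has exactly two sides. An arc is non-trivial if no component of its complement is a topological disk. Arcs are considered up to homotopy (respecting the ends), and all arcs are assumed non-trivial. An ideal triangulation of $X$ is a collection $\mu=\{\mu_i\}_{i\in\mathbb{N}}$ of pairwise disjoint, pairwise non-homotopic arcs such that each component of $X\setminus\mu$ is an open disk, each such disk is bounded by at most three sides of arcs, and each side of each arc is a side of one of these disks (so that $X$ is obtained by pasting ideal triangles together along their sides; in particular $\mu$ is locally finite). *)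

theory Defs
  imports "HOL-Analysis.Analysis" "HOL-Homology.Homology"
begin

section \<open>Surfaces\<close>

definition surface :: "'a topology \<Rightarrow> bool" where
  "surface X \<longleftrightarrow>
     connected_space X \<and> Hausdorff_space X \<and> second_countable X \<and>
     (\<forall>x \<in> topspace X. \<exists>U. openin X U \<and> x \<in> U \<and>
        subtopology X U homeomorphic_space (euclidean :: complex topology))"

text \<open>Orientations are taken in the homological sense: a choice of a generator \<open>\<omega> x\<close> of the local
  homology group \<open>H\<^sub>2(X, X - x)\<close> for every point \<open>x\<close>, which near every point is the
  restriction of a single class in \<open>H\<^sub>2(X, X - B)\<close>.\<close>

definition orientable :: "'a topology \<Rightarrow> bool" where
  "orientable X \<longleftrightarrow>
     (\<exists>\<omega>.
        (\<forall>x \<in> topspace X. \<omega> x \<in> carrier (relative_homology_group 2 X (topspace X - {x})) \<and>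
           carrier (relative_homology_group 2 X (topspace X - {x})) =
             generate (relative_homology_group 2 X (topspace X - {x})) {\<omega> x}) \<and>
        (\<forall>x \<in> topspace X. \<exists>B \<beta>. openin X B \<and> x \<in> B \<and>
           \<beta> \<in> carrier (relative_homology_group 2 X (topspace X - B)) \<and>
           (\<forall>y \<in> B. hom_induced 2 X (topspace X - B) X (topspace X - {y}) id \<beta> = \<omega> y)))"

definition open_disk :: "'a topology \<Rightarrow> 'a set \<Rightarrow> bool" where
  "open_disk X D \<longleftrightarrow>
     D \<subseteq> topspace X \<and> subtopology X D homeomorphic_space top_of_set (ball (0::complex) 1)"

text \<open>A subsurface is a subset that is a 2-manifold, possibly with boundary, in the subspace
  topology.\<close>

definition subsurface :: "'a topology \<Rightarrow> 'a set \<Rightarrow> bool" where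
  "subsurface X S \<longleftrightarrow>
     S \<subseteq> topspace X \<and>
     (\<forall>x \<in> S. \<exists>U V. openin (subtopology X S) U \<and> x \<in> U \<and>
        openin (top_of_set {z :: complex. 0 \<le> Im z}) V \<and>
        subtopology X U homeomorphic_space top_of_set V)"


section \<open>Ends\<close>

text \<open>The boundary of a member of the sequence is its frontier in \<open>X\<close>. For closed subsurfaces this
  is the manifold boundary; it is also the right notion for open ones.\<close>

definition end_sequence :: "'a topology \<Rightarrow> (nat \<Rightarrow> 'a set) \<Rightarrow> bool" where
  "end_sequence X U \<longleftrightarrow>
     decseq U \<and>
     (\<forall>i. subsurface X (U i) \<and> connectedin X (U i) \<and>
          \<not> compactin X (X closure_of U i) \<and> compactin X (X frontier_of U i)) \<and>
     (\<forall>K. compactin X K \<longrightarrow> (\<forall>\<^sub>F i in sequentially. U i \<inter> K = {}))"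

definition end_equiv :: "'a topology \<Rightarrow> ((nat \<Rightarrow> 'a set) \<times> (nat \<Rightarrow> 'a set)) set" where
  "end_equiv X =
     {(U, V). end_sequence X U \<and> end_sequence X V \<and>
        (\<forall>j. \<exists>i. U i \<subseteq> V j) \<and> (\<forall>i. \<exists>j. V j \<subseteq> U i)}"

definition ends :: "'a topology \<Rightarrow> (nat \<Rightarrow> 'a set) set set" where
  "ends X = Collect (end_sequence X) // end_equiv X"

definition converges_to_end :: "('b \<Rightarrow> 'a) \<Rightarrow> (nat \<Rightarrow> 'a set) set \<Rightarrow> 'b filter \<Rightarrow> bool" where
  "converges_to_end x e F \<longleftrightarrow> (\<forall>U \<in> e. \<forall>i. \<forall>\<^sub>F t in F. x t \<in> U i)"


section \<open>Arcs\<close>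

definition arc_map :: "'a topology \<Rightarrow> (real \<Rightarrow> 'a) \<Rightarrow> bool" where
  "arc_map X \<alpha> \<longleftrightarrow>
     embedding_map euclideanreal X \<alpha> \<and> proper_map euclideanreal X \<alpha> \<and>
     (\<exists>e \<in> ends X. converges_to_end \<alpha> e at_top) \<and>
     (\<exists>f \<in> ends X. converges_to_end \<alpha> f at_bot)"

definition arc_in :: "'a topology \<Rightarrow> 'a set \<Rightarrow> bool" where
  "arc_in X a \<longleftrightarrow> (\<exists>\<alpha>. arc_map X \<alpha> \<and> a = range \<alpha>)"

definition nontrivial_arc :: "'a topology \<Rightarrow> 'a set \<Rightarrow> bool" where
  "nontrivial_arc X a \<longleftrightarrow>
     arc_in X a \<and>
     (\<forall>C \<in> connected_components_of (subtopology X (topspace X - a)). \<not> open_disk X C)"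

text \<open>This relation is symmetric in the two ends, because \<open>\<alpha>\<close> may be replaced by its reverse.\<close>

definition arc_between ::
    "'a topology \<Rightarrow> 'a set \<Rightarrow> (nat \<Rightarrow> 'a set) set \<Rightarrow> (nat \<Rightarrow> 'a set) set \<Rightarrow> bool" where
  "arc_between X a e f \<longleftrightarrow>
     (\<exists>\<alpha>. arc_map X \<alpha> \<and> a = range \<alpha> \<and>
          converges_to_end \<alpha> e at_top \<and> converges_to_end \<alpha> f at_bot)"

text \<open>A homotopy respecting the ends: it converges to one end at \<open>+\<infinity>\<close> and to one end at
  \<open>-\<infinity>\<close>, uniformly in the homotopy parameter, i.e. it extends continuously to the end
  compactification with fixed endpoints. Without uniformity the part distinguishing two arcs with
  the same ends could be pushed off to infinity, and the relation would degenerate.\<close>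

definition arc_maps_homotopic :: "'a topology \<Rightarrow> (real \<Rightarrow> 'a) \<Rightarrow> (real \<Rightarrow> 'a) \<Rightarrow> bool" where
  "arc_maps_homotopic X \<alpha> \<beta> \<longleftrightarrow>
     (\<exists>H. continuous_map (prod_topology (top_of_set {0..1::real}) euclideanreal) X H \<and>
          (\<forall>t. H (0, t) = \<alpha> t) \<and> (\<forall>t. H (1, t) = \<beta> t) \<and>
          (\<exists>e \<in> ends X. \<forall>U \<in> e. \<forall>i. \<forall>\<^sub>F t in at_top. \<forall>s \<in> {0..1}. H (s, t) \<in> U i) \<and>
          (\<exists>f \<in> ends X. \<forall>U \<in> f. \<forall>i. \<forall>\<^sub>F t in at_bot. \<forall>s \<in> {0..1}. H (s, t) \<in> U i))"

definition arcs_homotopic :: "'a topology \<Rightarrow> 'a set \<Rightarrow> 'a set \<Rightarrow> bool" where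
  "arcs_homotopic X a b \<longleftrightarrow>
     (\<exists>\<alpha> \<beta>. arc_map X \<alpha> \<and> a = range \<alpha> \<and> arc_map X \<beta> \<and> b = range \<beta> \<and>
            arc_maps_homotopic X \<alpha> \<beta>)"


section \<open>Sides of arcs\<close>

definition tubular_nbhd :: "'a topology \<Rightarrow> 'a set \<Rightarrow> (real \<times> real \<Rightarrow> 'a) \<Rightarrow> bool" where
  "tubular_nbhd X a h \<longleftrightarrow>
     embedding_map (prod_topology euclideanreal (top_of_set {-1<..<1})) X h \<and>
     openin X (h ` (UNIV \<times> {-1<..<1})) \<and>
     h ` (UNIV \<times> {0}) = a"

text \<open>A side of an arc is identified with the family of its one-sided neighbourhoods: the sets that
  contain all points of one half of a tubular neighbourhood sufficiently close to the arc. This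
  family does not depend on the tubular neighbourhood. The other half is obtained by reflecting
  \<open>h\<close> in the second coordinate.\<close>

definition arc_sides :: "'a topology \<Rightarrow> 'a set \<Rightarrow> 'a set set set" where
  "arc_sides X a =
     {{N. N \<subseteq> topspace X \<and> (\<exists>W. openin X W \<and> a \<subseteq> W \<and> W \<inter> h ` (UNIV \<times> {0<..<1}) \<subseteq> N)}
      | h. tubular_nbhd X a h}"


section \<open>Ideal triangulations\<close>

definition faces :: "'a topology \<Rightarrow> 'a set set \<Rightarrow> 'a set set" where
  "faces X \<mu> = connected_components_of (subtopology X (topspace X - \<Union>\<mu>))"

text \<open>\<open>\<sigma>\<close> is a side of \<open>D\<close> iff \<open>D\<close> is a one-sided neighbourhood for \<open>\<sigma>\<close>. An arc both of whose sides
  are sides of \<open>D\<close> is counted twice.\<close>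

definition face_sides :: "'a topology \<Rightarrow> 'a set set \<Rightarrow> 'a set \<Rightarrow> ('a set \<times> 'a set set) set" where
  "face_sides X \<mu> D = {(a, \<sigma>). a \<in> \<mu> \<and> \<sigma> \<in> arc_sides X a \<and> D \<in> \<sigma>}"

text \<open>That an arc has exactly two sides is not a restriction on \<open>\<mu>\<close>: it holds for every arc of an
  orientable surface, by the Schoenflies theorem. It is recorded explicitly so that the condition on
  the sides of an arc is visibly not vacuous.\<close>

definition ideal_triangulation :: "'a topology \<Rightarrow> 'a set set \<Rightarrow> bool" where
  "ideal_triangulation X \<mu> \<longleftrightarrow>
     countable \<mu> \<and>
     (\<forall>a \<in> \<mu>. nontrivial_arc X a) \<and>
     pairwise disjnt \<mu> \<and>
     pairwise (\<lambda>a b. \<not> arcs_homotopic X a b) \<mu> \<and>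
     (\<forall>D \<in> faces X \<mu>.
        open_disk X D \<and>
        X frontier_of D = \<Union> (fst ` face_sides X \<mu> D) \<and>
        finite (face_sides X \<mu> D) \<and> card (face_sides X \<mu> D) \<le> 3) \<and>
     (\<forall>a \<in> \<mu>. card (arc_sides X a) = 2 \<and>
        (\<forall>\<sigma> \<in> arc_sides X a. \<exists>D \<in> faces X \<mu>. (a, \<sigma>) \<in> face_sides X \<mu> D))"

end

theory Submission
  imports Defs
begin

text \<open>Two distinct ends are separated by the compact frontier of a member of one of their defining
  sequences, and every arc between them must cross it. On the other hand \<open>\<mu>\<close> is locally finite:
  faces are open, since their frontiers lie in \<open>\<Union>\<mu>\<close>, and a point of an arc has a
  neighbourhood contained in the arc and the faces on its two sides. So only finitely many arcs
  meet the separating compact set.\<close>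

text \<open>\<open>arc_sides\<close> reads only the half of a tube with positive second coordinate.
  Precomposing with the reflection makes the other half available as a side too.\<close>

lemma tubular_nbhd_reflect:
  assumes "tubular_nbhd X a h"
  shows "tubular_nbhd X a (h \<circ> map_prod id uminus)"
proof -
  let ?I = "{-1<..<1::real}"
  let ?P = "prod_topology euclideanreal (top_of_set ?I)"
  let ?r = "map_prod id uminus :: real \<times> real \<Rightarrow> real \<times> real"
  have r: "?r ` (UNIV \<times> ?I) = UNIV \<times> ?I" "?r ` (UNIV \<times> {0}) = UNIV \<times> {0}"
    by (simp_all add: map_prod_surj_on)
  \<comment> \<open>In this form continuity of the reflection \<open>?r\<close> becomes
    \<open>continuous_on\<close> on a subset of the plane.\<close>
  have P: "?P = top_of_set (UNIV \<times> ?I)"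
    using prod_topology_subtopology_eu[of UNIV ?I] by simp
  have "continuous_on (UNIV \<times> ?I) ?r"
    by (simp add: map_prod_def case_prod_unfold continuous_intros)
  then have "homeomorphic_map ?P ?P ?r"
    unfolding P using r(1) by (intro homeomorphic_map_involution) auto
  then have "embedding_map ?P ?P ?r"
    by (metis embedding_map_def homeomorphic_imp_surjective_map subtopology_topspace)
  then have "embedding_map ?P X (h \<circ> ?r)"
    using assms embedding_map_compose unfolding tubular_nbhd_def by blast
  then show ?thesis
    using assms unfolding tubular_nbhd_def image_comp[symmetric] r by simp
qed

text \<open>A subset of the space that is disjoint from its frontier is open. A face misses every
  arc, and its frontier consists of arcs.\<close>

lemma openin_face:
  assumes "ideal_triangulation X \<mu>" "D \<in> faces X \<mu>"
  shows "openin X D"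
proof -
  have D: "D \<subseteq> topspace X - \<Union>\<mu>"
    using assms(2) connected_components_of_subset unfolding faces_def by fastforce
  have "X frontier_of D \<subseteq> \<Union>\<mu>"
    using assms unfolding ideal_triangulation_def face_sides_def by fastforce
  with D have "D \<inter> X frontier_of D = {}"
    by blast
  with D show ?thesis
    by (metis Diff_subset frontier_of_disjoint_eq inf_commute subset_trans)
qed

text \<open>Close to \<open>a\<close>, each half of a tube around \<open>a\<close> lies in a face,
  and faces miss all arcs. Only the core of the tube, which is \<open>a\<close> itself, can then
  meet \<open>\<mu>\<close>.\<close>

lemma arc_nbhd_avoiding_others:
  assumes \<mu>: "ideal_triangulation X \<mu>" and a: "a \<in> \<mu>"
  obtains W where "openin X W" "a \<subseteq> W" "W \<inter> \<Union>\<mu> \<subseteq> a"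
proof -
  \<comment> \<open>Having two sides guarantees a tubular neighbourhood, because every side is built
    from one.\<close>
  have "card (arc_sides X a) = 2"
    using \<mu> a unfolding ideal_triangulation_def by blast
  then have "arc_sides X a \<noteq> {}"
    by auto
  then obtain h where h: "tubular_nbhd X a h"
    unfolding arc_sides_def by blast
  \<comment> \<open>The tube \<open>g\<close> is arbitrary here, so that the claim applies both to
    \<open>h\<close> and to its reflection.\<close>
  have half: "\<exists>W. openin X W \<and> a \<subseteq> W \<and> W \<inter> g ` (UNIV \<times> {0<..<1}) \<inter> \<Union>\<mu> = {}"
    if g: "tubular_nbhd X a g" for g
  proof -
    let ?\<sigma> = "{N. N \<subseteq> topspace X \<and>
      (\<exists>W. openin X W \<and> a \<subseteq> W \<and> W \<inter> g ` (UNIV \<times> {0<..<1}) \<subseteq> N)}"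
    have "?\<sigma> \<in> arc_sides X a"
      unfolding arc_sides_def using g by blast
    \<comment> \<open>Membership of the face \<open>D\<close> in the side \<open>?\<sigma>\<close>
      says exactly that \<open>D\<close> contains the half tube near \<open>a\<close>.\<close>
    then obtain D where D: "D \<in> faces X \<mu>" "D \<in> ?\<sigma>"
      using \<mu> a unfolding ideal_triangulation_def face_sides_def by blast
    have "D \<inter> \<Union>\<mu> = {}"
      using D(1) connected_components_of_subset unfolding faces_def by fastforce
    with D(2) show ?thesis
      by blast
  qed
  obtain W1 where W1: "openin X W1" "a \<subseteq> W1" "W1 \<inter> h ` (UNIV \<times> {0<..<1}) \<inter> \<Union>\<mu> = {}"
    using half[OF h] by metis
  obtain W2 where W2: "openin X W2" "a \<subseteq> W2"
      "W2 \<inter> (h \<circ> map_prod id uminus) ` (UNIV \<times> {0<..<1}) \<inter> \<Union>\<mu> = {}"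
    using half[OF tubular_nbhd_reflect[OF h]] by metis
  let ?T = "h ` (UNIV \<times> {-1<..<1})"
  have T: "openin X ?T" "h ` (UNIV \<times> {0}) = a"
    using h unfolding tubular_nbhd_def by auto
  have "map_prod id uminus ` ((UNIV :: real set) \<times> {0<..<1}) = UNIV \<times> {-1<..<0::real}"
    by (simp add: map_prod_surj_on[OF refl refl])
  moreover have "{-1<..<1} = {0<..<1} \<union> {0} \<union> {-1<..<0::real}"
    by auto
  ultimately have "(UNIV :: real set) \<times> {-1<..<1} = UNIV \<times> {0<..<1} \<union> UNIV \<times> {0} \<union>
      map_prod id uminus ` (UNIV \<times> {0<..<1::real})"
    by (simp only: Sigma_Un_distrib2)
  \<comment> \<open>The tube splits into its upper half, the arc \<open>a\<close> and its lower
    half, seen as the upper half of the reflected tube.\<close>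
  then have T_eq: "?T = h ` (UNIV \<times> {0<..<1}) \<union> a \<union> (h \<circ> map_prod id uminus) ` (UNIV \<times> {0<..<1})"
    by (simp only: image_Un image_comp T(2))
  show thesis
  proof
    show "openin X (W1 \<inter> W2 \<inter> ?T)"
      using W1 W2 T by blast
    show "a \<subseteq> W1 \<inter> W2 \<inter> ?T"
      using W1(2) W2(2) T_eq by blast
    show "W1 \<inter> W2 \<inter> ?T \<inter> \<Union>\<mu> \<subseteq> a"
      using W1(3) W2(3) unfolding T_eq by blast
  qed
qed

text \<open>A point on an arc has a neighbourhood meeting that arc only; a point off the arcs lies
  in a face, which is open and meets none.\<close>

lemma ideal_triangulation_locally_finite:
  assumes \<mu>: "ideal_triangulation X \<mu>" and x: "x \<in> topspace X"
  obtains W where "openin X W" "x \<in> W" "finite {a \<in> \<mu>. a \<inter> W \<noteq> {}}"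
proof (cases "x \<in> \<Union>\<mu>")
  case True
  then obtain a where a: "a \<in> \<mu>" "x \<in> a"
    by blast
  obtain W where W: "openin X W" "a \<subseteq> W" "W \<inter> \<Union>\<mu> \<subseteq> a"
    using arc_nbhd_avoiding_others[OF \<mu> a(1)] .
  have "pairwise disjnt \<mu>"
    using \<mu> unfolding ideal_triangulation_def by (elim conjE)
  then have "{b \<in> \<mu>. b \<inter> W \<noteq> {}} \<subseteq> {a}"
    using a(1) W(3) unfolding pairwise_def disjnt_def by blast
  then have "finite {b \<in> \<mu>. b \<inter> W \<noteq> {}}"
    using finite_subset by blast
  then show ?thesis
    using that W(1,2) a(2) by blast
next
  case False
  then have "x \<in> \<Union>(faces X \<mu>)"
    unfolding faces_def Union_connected_components_of using x by simp
  then obtain D where D: "D \<in> faces X \<mu>" "x \<in> D"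
    by blast
  have "D \<inter> \<Union>\<mu> = {}"
    using D(1) connected_components_of_subset unfolding faces_def by fastforce
  then have "{a \<in> \<mu>. a \<inter> D \<noteq> {}} = {}"
    by blast
  then have "finite {a \<in> \<mu>. a \<inter> D \<noteq> {}}"
    by (simp only: finite.emptyI)
  then show ?thesis
    using that openin_face[OF \<mu> D(1)] D(2) by blast
qed

lemma finite_arcs_meeting_compact:
  assumes \<mu>: "ideal_triangulation X \<mu>" and K: "compactin X K"
  shows "finite {a \<in> \<mu>. a \<inter> K \<noteq> {}}"
proof -
  let ?\<U> = "{W. openin X W \<and> finite {a \<in> \<mu>. a \<inter> W \<noteq> {}}}"
  have "K \<subseteq> \<Union>?\<U>"
    using compactin_subset_topspace[OF K] ideal_triangulation_locally_finite[OF \<mu>] by blast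
  then obtain \<F> where \<F>: "finite \<F>" "\<F> \<subseteq> ?\<U>" "K \<subseteq> \<Union>\<F>"
    using compactinD[OF K, of ?\<U>] by blast
  have "{a \<in> \<mu>. a \<inter> K \<noteq> {}} \<subseteq> (\<Union>W\<in>\<F>. {a \<in> \<mu>. a \<inter> W \<noteq> {}})"
    using \<F>(3) by blast
  moreover have "finite (\<Union>W\<in>\<F>. {a \<in> \<mu>. a \<inter> W \<noteq> {}})"
    using \<F>(1,2) by blast
  ultimately show ?thesis
    by (rule finite_subset)
qed

lemma end_representative:
  assumes "e \<in> ends X"
  obtains U where "end_sequence X U" "U \<in> e" "e = end_equiv X `` {U}"
  using assms unfolding ends_def quotient_def end_equiv_def by auto

lemma equiv_end_equiv: "equiv (Collect (end_sequence X)) (end_equiv X)"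
proof (rule equivI)
  show "trans (end_equiv X)"
    unfolding end_equiv_def by (rule transI, clarsimp) (meson subset_trans)
qed (auto simp: refl_on_def sym_def end_equiv_def)

text \<open>A late \<open>U i\<close> avoids the compact frontier of \<open>V j\<close>. Being
  connected, it lies either inside \<open>V j\<close>, which is excluded by assumption, or
  outside.\<close>

lemma end_sequence_eventually_disjoint:
  assumes U: "end_sequence X U" and V: "end_sequence X V" and "\<And>i. \<not> U i \<subseteq> V j"
  obtains i where "U i \<inter> V j = {}"
proof -
  have "compactin X (X frontier_of V j)"
    using V unfolding end_sequence_def by blast
  then obtain i where "U i \<inter> X frontier_of V j = {}"
    using U unfolding end_sequence_def eventually_sequentially by blast
  moreover have "connectedin X (U i)"
    using U unfolding end_sequence_def by blast
  ultimately have "U i \<inter> V j = {}"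
    using connectedin_Int_frontier_of[of X "U i" "V j"] assms(3)[of i] by blast
  then show thesis ..
qed

text \<open>The connected arc has points in \<open>V\<close> and, through \<open>U\<close>, points
  outside \<open>V\<close>. The filters are left general so that \<open>at_top\<close> and
  \<open>at_bot\<close> can take either role.\<close>

lemma arc_meets_frontier:
  assumes arc: "arc_map X \<alpha>"
    and U: "\<forall>\<^sub>F t in F. \<alpha> t \<in> U" "F \<noteq> bot"
    and V: "\<forall>\<^sub>F t in G. \<alpha> t \<in> V" "G \<noteq> bot"
    and disj: "U \<inter> V = {}"
  shows "range \<alpha> \<inter> X frontier_of V \<noteq> {}"
proof -
  have "continuous_map euclideanreal X \<alpha>"
    using arc homeomorphic_imp_continuous_map continuous_map_in_subtopology
    unfolding arc_map_def embedding_map_def by blast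
  then have "connectedin X (range \<alpha>)"
    using connectedin_continuous_map_image[of euclideanreal X \<alpha> UNIV] by simp
  moreover obtain s where "\<alpha> s \<in> U"
    using U eventually_happens by blast
  moreover obtain t where "\<alpha> t \<in> V"
    using V eventually_happens by blast
  ultimately show ?thesis
    using disj connectedin_Int_frontier_of[of X "range \<alpha>" V] by blast
qed

lemma distinct_ends_compact_separator:
  assumes e: "e \<in> ends X" and f: "f \<in> ends X" and ne: "e \<noteq> f"
  obtains K where "compactin X K" "\<And>a. arc_between X a e f \<Longrightarrow> a \<inter> K \<noteq> {}"
proof -
  obtain U where U: "end_sequence X U" "U \<in> e" "e = end_equiv X `` {U}"
    using end_representative[OF e] .
  obtain V where V: "end_sequence X V" "V \<in> f" "f = end_equiv X `` {V}"
    using end_representative[OF f] .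
  have "(U, V) \<notin> end_equiv X"
    using ne U(3) V(3) equiv_class_eq[OF equiv_end_equiv] by blast
  \<comment> \<open>Equivalence of end sequences is mutual cofinality, so one of its two directions
    fails. Each failure provides a member whose frontier will be the separator.\<close>
  then consider j where "\<And>i. \<not> U i \<subseteq> V j" | j where "\<And>i. \<not> V i \<subseteq> U j"
    using U(1) V(1) unfolding end_equiv_def by blast
  then show thesis
  proof cases
    case 1
    obtain i where "U i \<inter> V j = {}"
      using end_sequence_eventually_disjoint[OF U(1) V(1) 1] .
    then have "a \<inter> X frontier_of V j \<noteq> {}" if "arc_between X a e f" for a
      using that U(2) V(2) arc_meets_frontier[where F = at_top and G = at_bot and U = "U i"]
      unfolding arc_between_def converges_to_end_def by force
    moreover have "compactin X (X frontier_of V j)"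
      using V(1) unfolding end_sequence_def by blast
    ultimately show thesis
      using that by blast
  next
    \<comment> \<open>The roles of the ends are exchanged: the frontier now comes from
      \<open>U\<close>, and the arc reaches the disjoint set \<open>V i\<close> at
      \<open>at_bot\<close>.\<close>
    case 2
    obtain i where "V i \<inter> U j = {}"
      using end_sequence_eventually_disjoint[OF V(1) U(1) 2] .
    then have "a \<inter> X frontier_of U j \<noteq> {}" if "arc_between X a e f" for a
      using that U(2) V(2) arc_meets_frontier[where F = at_bot and G = at_top and U = "V i"]
      unfolding arc_between_def converges_to_end_def by force
    moreover have "compactin X (X frontier_of U j)"
      using U(1) unfolding end_sequence_def by blast
    ultimately show thesis
      using that by blast
  qed
qed

theorem corollary1p3:
  fixes X :: "'a topology" and \<mu> :: "'a set set" and e f :: "(nat \<Rightarrow> 'a set) set"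
  assumes "surface X" and "orientable X"
    and "ideal_triangulation X \<mu>"
    and "e \<in> ends X" and "f \<in> ends X" and "e \<noteq> f"
  shows "finite {a \<in> \<mu>. arc_between X a e f}"
proof -
  obtain K where K: "compactin X K" "\<And>a. arc_between X a e f \<Longrightarrow> a \<inter> K \<noteq> {}"
    using distinct_ends_compact_separator[OF assms(4-6)] by metis
  then have "{a \<in> \<mu>. arc_between X a e f} \<subseteq> {a \<in> \<mu>. a \<inter> K \<noteq> {}}"
    by blast
  then show ?thesis
    using finite_arcs_meeting_compact[OF assms(3) K(1)] finite_subset by blast
qed

end
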